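(* Let $(\mathcal{Q},\mathcal{P})$ be a reduced bipartite monoid with $1 \notin \mathcal{P}$. Then the following are equivalent: (i) there exists a closed set of games $\mathscr{A}$ with $\mathcal{Q}(\mathscr{A}) \cong (\mathcal{Q},\mathcal{P})$; (ii) there exists a valid transition table on $(\mathcal{Q},\mathcal{P})$.
   Context: Impartial games: a game is the set of its options; $0=\emptyset$; $G+H$ has options $G'+H$, $G+H'$. Misère play: $G$ is a $\mathscr{P}$-position iff $G\ne0$ and every option is an $\mathscr{N}$-position. A set of games is closed if it contains $0$ and is closed under options and sums. For closed $\mathscr{A}$, $G\equiv_\mathscr{A}H$ iff $G+X$, $H+X$ have the same misère outcome for all $X\in\mathscr{A}$; $\mathcal{Q}(\mathscr{A})$ is the commutative monoid $\mathscr{A}/{\equiv_\mathscr{A}}$ with distinguished subset the classes of $\mathscr{P}$-positions. A bipartite monoid is a commutative monoid $\mathcal{Q}$ with a subset $\mathcal{P}$; it is reduced if for all $x\ne y$ there is $w\in\mathcal{Q}$ with exactly one of $xw,yw$ in $\mathcal{P}$. A transition table on $\mathcal{Q}$ is a subset $T\subseteq \mathcal{Q}\times\mathrm{Pow}(\mathcal{Q})$. For $x\in\mathcal{Q}$ and $\mathcal{F}\subseteq\mathcal{Q}$, $x\mathcal{F}=\{xy:y\in\mathcal{F}\}$. $T$ is valid if: (i) (parity) for each $(x,\mathcal{E})\in T$, $x\in\mathcal{P}\iff(\mathcal{E}\ne\emptyset$ and $\mathcal{E}\cap\mathcal{P}=\emptyset)$; (ii) (completeness) for each $x\in\mathcal{Q}$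 some $(x,\mathcal{E})\in T$; (iii) (closure) if $(x,\mathcal{E}),(y,\mathcal{F})\in T$ then $(xy,x\mathcal{F}\cup y\mathcal{E})\in T$; (iv) (well-foundedness) there is a map $R:\mathcal{Q}\to\mathbb{N}$ with $R(1)=0$ such that for each $x\in\mathcal{Q}$ there is $(x,\mathcal{E})\in T$ with $R(y)<R(x)$ for all $y\in\mathcal{E}$. *)

theory Defs
  imports "HOL-Algebra.Group" "HOL-Library.FSet"
begin

text \<open>
  A game is the finite set of its options, hereditarily, and two games with the same options are
  equal: \<open>game\<close> is the type of hereditarily finite sets. Finiteness of games is what matches the
  requirement below that the rank function of a valid transition table takes values in the
  natural numbers.
\<close>

datatype game = Game (options: "game fset")

lemma size_option_less: "G' |\<in>| options G \<Longrightarrow> size G' < size G"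
proof (cases G)
  case (Game S)
  assume "G' |\<in>| options G"
  then have "G' \<in> fset S" using Game by simp
  then have "Suc (size G') \<le> (\<Sum>x\<in>fset S. Suc (size x))"
    by (intro member_le_sum) auto
  then show ?thesis using Game by simp
qed

instantiation game :: comm_monoid_add
begin

definition zero_game :: game where
  "zero_game = Game {||}"

function plus_game :: "game \<Rightarrow> game \<Rightarrow> game" where
  "plus_game G H =
     Game ((\<lambda>G'. plus_game G' H) |`| options G |\<union>| (\<lambda>H'. plus_game G H') |`| options H)"
  by pat_completeness auto
termination
  by (relation "measure (\<lambda>(G, H). size G + size H)") (auto dest: size_option_less)

declare plus_game.simps [simp del]

lemma options_plus:
  "options (G + H) = (\<lambda>G'. G' + H) |`| options G |\<union>| (\<lambda>H'. G + H') |`| options H"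
  by (subst plus_game.simps) simp

instance
proof
  fix G H K :: game
  show "G + H = H + G"
  proof (induction "size G + size H" arbitrary: G H rule: less_induct)
    case less
    have 1: "(\<lambda>G'. G' + H) |`| options G = (\<lambda>G'. H + G') |`| options G"
      by (intro fimage_cong refl less) (simp add: size_option_less)
    have 2: "(\<lambda>H'. G + H') |`| options H = (\<lambda>H'. H' + G) |`| options H"
      by (intro fimage_cong refl less) (simp add: size_option_less)
    show ?case
      by (rule game.expand) (simp only: options_plus 1 2 sup_commute)
  qed
  show "G + H + K = G + (H + K)"
  proof (induction "size G + size H + size K" arbitrary: G H K rule: less_induct)
    case less
    have 1: "(\<lambda>G'. G' + H + K) |`| options G = (\<lambda>G'. G' + (H + K)) |`| options G"
      by (intro fimage_cong refl less) (simp add: size_option_less)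
    have 2: "(\<lambda>H'. G + H' + K) |`| options H = (\<lambda>H'. G + (H' + K)) |`| options H"
      by (intro fimage_cong refl less) (simp add: size_option_less)
    have 3: "(\<lambda>K'. G + H + K') |`| options K = (\<lambda>K'. G + (H + K')) |`| options K"
      by (intro fimage_cong refl less) (simp add: size_option_less)
    show ?case
      by (rule game.expand)
         (simp only: options_plus fimage_funion fset.map_comp comp_def sup_assoc 1 2 3)
  qed
  show "0 + G = G"
  proof (induction "size G" arbitrary: G rule: less_induct)
    case less
    have "(\<lambda>G'. 0 + G') |`| options G = (\<lambda>G'. G') |`| options G"
      by (intro fimage_cong refl less) (simp add: size_option_less)
    then show ?case
      by (intro game.expand) (simp add: options_plus zero_game_def)
  qed
qed

end

function misere_P :: "game \<Rightarrow> bool" where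
  "misere_P G \<longleftrightarrow> G \<noteq> 0 \<and> (\<forall>G'. G' |\<in>| options G \<longrightarrow> \<not> misere_P G')"
  by pat_completeness auto
termination
  by (relation "measure size") (auto dest: size_option_less)

declare misere_P.simps [simp del]

definition closed_games :: "game set \<Rightarrow> bool" where
  "closed_games A \<longleftrightarrow>
     0 \<in> A \<and> (\<forall>G\<in>A. \<forall>G'. G' |\<in>| options G \<longrightarrow> G' \<in> A) \<and> (\<forall>G\<in>A. \<forall>H\<in>A. G + H \<in> A)"

definition indist :: "game set \<Rightarrow> (game \<times> game) set" where
  "indist A =
     {(G, H). G \<in> A \<and> H \<in> A \<and> (\<forall>X\<in>A. misere_P (G + X) \<longleftrightarrow> misere_P (H + X))}"

text \<open>
  The product of two classes is written as the union of the classes of the sums of representatives;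
  for closed \<open>A\<close> this union consists of a single class, see \<open>misere_quotient_mult\<close>.
\<close>

definition misere_quotient :: "game set \<Rightarrow> game set monoid" where
  "misere_quotient A =
     \<lparr>carrier = A // indist A,
      mult = (\<lambda>X Y. \<Union>G\<in>X. \<Union>H\<in>Y. indist A `` {G + H}),
      one = indist A `` {0}\<rparr>"

definition misere_quotient_P :: "game set \<Rightarrow> game set set" where
  "misere_quotient_P A = {indist A `` {G} |G. G \<in> A \<and> misere_P G}"

locale bipartite_monoid = comm_monoid Q for Q (structure) +
  fixes P
  assumes P_subset: "P \<subseteq> carrier Q"

locale reduced_bipartite_monoid = bipartite_monoid +
  assumes reduced:
    "\<lbrakk>x \<in> carrier Q; y \<in> carrier Q; x \<noteq> y\<rbrakk> \<Longrightarrow>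
      \<exists>w\<in>carrier Q. (x \<otimes> w \<in> P) \<noteq> (y \<otimes> w \<in> P)"

text \<open>Elements of \<open>iso\<close> preserve the unit automatically, being surjective.\<close>

definition bipartite_isomorphic ::
  "('a, 'c) monoid_scheme \<Rightarrow> 'a set \<Rightarrow> ('b, 'd) monoid_scheme \<Rightarrow> 'b set \<Rightarrow> bool" where
  "bipartite_isomorphic Q P Q' P' \<longleftrightarrow>
     (\<exists>h\<in>iso Q Q'. \<forall>x\<in>carrier Q. x \<in> P \<longleftrightarrow> h x \<in> P')"

text \<open>
  Only the values of the rank function \<open>R\<close> on the carrier matter, since
  \<open>T \<subseteq> carrier Q \<times> Pow (carrier Q)\<close>.
\<close>

definition valid_transition_table ::
  "('a, 'c) monoid_scheme \<Rightarrow> 'a set \<Rightarrow> ('a \<times> 'a set) set \<Rightarrow> bool" where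
  "valid_transition_table Q P T \<longleftrightarrow>
     T \<subseteq> carrier Q \<times> Pow (carrier Q) \<and>
     (\<forall>(x, E)\<in>T. x \<in> P \<longleftrightarrow> E \<noteq> {} \<and> E \<inter> P = {}) \<and>
     (\<forall>x\<in>carrier Q. \<exists>E. (x, E) \<in> T) \<and>
     (\<forall>(x, E)\<in>T. \<forall>(y, F)\<in>T.
        (x \<otimes>\<^bsub>Q\<^esub> y, (\<lambda>z. x \<otimes>\<^bsub>Q\<^esub> z) ` F \<union> (\<lambda>z. y \<otimes>\<^bsub>Q\<^esub> z) ` E) \<in> T) \<and>
     (\<exists>R :: 'a \<Rightarrow> nat. R \<one>\<^bsub>Q\<^esub> = 0 \<and>
        (\<forall>x\<in>carrier Q. \<exists>E. (x, E) \<in> T \<and> (\<forall>y\<in>E. R y < R x)))"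

lemma equiv_indist: "equiv A (indist A)"
  by (auto simp: equiv_def refl_on_def sym_def trans_def indist_def)

lemma indist_plus:
  assumes "closed_games A" "(G, G') \<in> indist A" "(H, H') \<in> indist A"
  shows "(G + H, G' + H') \<in> indist A"
proof -
  have A: "G \<in> A" "G' \<in> A" "H \<in> A" "H' \<in> A"
    using assms by (auto simp: indist_def)
  have plus: "K + L \<in> A" if "K \<in> A" "L \<in> A" for K L
    using assms(1) that by (auto simp: closed_games_def)
  have "misere_P (G + H + X) \<longleftrightarrow> misere_P (G' + H' + X)" if X: "X \<in> A" for X
  proof -
    have "misere_P (G + (H + X)) \<longleftrightarrow> misere_P (G' + (H + X))"
      using assms(2) plus[OF A(3) X] by (auto simp: indist_def)
    moreover have "misere_P (H + (G' + X)) \<longleftrightarrow> misere_P (H' + (G' + X))"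
      using assms(3) plus[OF A(2) X] by (auto simp: indist_def)
    ultimately show ?thesis by (simp add: ac_simps)
  qed
  then show ?thesis using A plus by (auto simp: indist_def)
qed

lemma misere_quotient_mult:
  assumes "closed_games A" "G \<in> A" "H \<in> A"
  shows "indist A `` {G} \<otimes>\<^bsub>misere_quotient A\<^esub> indist A `` {H} = indist A `` {G + H}"
proof -
  have eq: "indist A `` {G' + H'} = indist A `` {G + H}"
    if "G' \<in> indist A `` {G}" "H' \<in> indist A `` {H}" for G' H'
  proof (rule equiv_class_eq[OF equiv_indist, symmetric])
    show "(G + H, G' + H') \<in> indist A"
      by (rule indist_plus[OF assms(1)]) (use that in blast)+
  qed
  have G: "G \<in> indist A `` {G}" and H: "H \<in> indist A `` {H}"
    using equiv_class_self[OF equiv_indist] assms by blast+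
  have "(\<Union>G'\<in>indist A `` {G}. \<Union>H'\<in>indist A `` {H}. indist A `` {G' + H'}) =
        (\<Union>G'\<in>indist A `` {G}. \<Union>H'\<in>indist A `` {H}. indist A `` {G + H})"
    by (intro SUP_cong refl eq)
  also have "\<dots> = indist A `` {G + H}"
    using G H by (simp only: UN_constant) auto
  finally show ?thesis
    by (simp only: misere_quotient_def monoid.simps)
qed

lemma bipartite_monoid_misere_quotient:
  assumes "closed_games A"
  shows "bipartite_monoid (misere_quotient A) (misere_quotient_P A)"
proof -
  have carr: "carrier (misere_quotient A) = (\<lambda>G. indist A `` {G}) ` A"
    by (auto simp: misere_quotient_def quotient_def)
  have one: "\<one>\<^bsub>misere_quotient A\<^esub> = indist A `` {0}"
    by (simp add: misere_quotient_def)
  have A: "0 \<in> A" "\<And>G H. G \<in> A \<Longrightarrow> H \<in> A \<Longrightarrow> G + H \<in> A"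
    using assms by (auto simp: closed_games_def)
  note mult = misere_quotient_mult[OF assms]
  show ?thesis
  proof
    show "misere_quotient_P A \<subseteq> carrier (misere_quotient A)"
      unfolding carr misere_quotient_P_def by auto
  qed (use A in \<open>auto simp: carr one mult ac_simps\<close>)
qed

end

theory Submission
  imports Defs
begin

text \<open>
  If \<open>A\<close> has quotient \<open>Q\<close> via \<open>\<phi>\<close>, then the pairs \<open>(\<phi> G, \<phi> ` options G)\<close> form a valid table, ranked by
  the least size of a game of a given value. Conversely, from a valid table \<open>T\<close> take all games whose
  options can be valued, hereditarily, along entries of \<open>T\<close>; parity makes the value of a game decide
  its outcome, and reducedness makes it unique. Every \<open>x\<close> is a value: by reducedness, parity and
  closure, \<open>x\<close> is determined by any set \<open>E\<close> with \<open>(x, E) \<in> T\<close>, so there are finitely many elements of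
  each rank, and the entries supplied by well-foundedness have finite option sets.
\<close>

section \<open>Options, sizes and closed sets of games\<close>

lemma options_zero [simp]: "options 0 = {||}"
  by (simp add: zero_game_def)

lemma options_eq_empty_iff [simp]: "options G = {||} \<longleftrightarrow> G = 0"
  by (cases G) (simp add: zero_game_def)

lemma fset_options_eq_empty_iff [simp]: "fset (options G) = {} \<longleftrightarrow> G = 0"
  by (metis bot_fset.rep_eq fset_inject options_eq_empty_iff)

lemma size_zero_game [simp]: "size (0 :: game) = 1"
  by (simp add: zero_game_def)

lemma size_game_pos: "0 < size (G :: game)"
  by (cases G) simp

lemma fset_options_plus:
  "fset (options (G + H)) = (\<lambda>G'. G' + H) ` fset (options G) \<union> (\<lambda>H'. G + H') ` fset (options H)"
  by (simp add: options_plus)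

lemma closed_gamesD:
  assumes "closed_games A"
  shows "0 \<in> A"
    and "\<And>G G'. G \<in> A \<Longrightarrow> G' |\<in>| options G \<Longrightarrow> G' \<in> A"
    and "\<And>G H. G \<in> A \<Longrightarrow> H \<in> A \<Longrightarrow> G + H \<in> A"
  using assms unfolding closed_games_def by blast+

section \<open>From a valuation of games to a transition table\<close>

lemma valid_transition_tableI:
  fixes Q (structure) and R :: "'a \<Rightarrow> nat"
  assumes "T \<subseteq> carrier Q \<times> Pow (carrier Q)"
    and parity: "\<And>x E. (x, E) \<in> T \<Longrightarrow> x \<in> P \<longleftrightarrow> E \<noteq> {} \<and> E \<inter> P = {}"
    and complete: "\<And>x. x \<in> carrier Q \<Longrightarrow> \<exists>E. (x, E) \<in> T"
    and closure: "\<And>x E y F. \<lbrakk>(x, E) \<in> T; (y, F) \<in> T\<rbrakk> \<Longrightarrow>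
      (x \<otimes> y, (\<lambda>z. x \<otimes> z) ` F \<union> (\<lambda>z. y \<otimes> z) ` E) \<in> T"
    and "R \<one> = 0"
    and rank: "\<And>x. x \<in> carrier Q \<Longrightarrow> \<exists>E. (x, E) \<in> T \<and> (\<forall>y\<in>E. R y < R x)"
  shows "valid_transition_table Q P T"
  unfolding valid_transition_table_def
proof (intro conjI exI[of _ R] ballI)
  show "case p of (x, E) \<Rightarrow> x \<in> P \<longleftrightarrow> E \<noteq> {} \<and> E \<inter> P = {}" if "p \<in> T" for p
    using parity that by (cases p) simp
  show "case p of (x, E) \<Rightarrow> \<forall>(y, F)\<in>T.
      (x \<otimes> y, (\<lambda>z. x \<otimes> z) ` F \<union> (\<lambda>z. y \<otimes> z) ` E) \<in> T" if "p \<in> T" for p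
    using closure that by (cases p) (simp add: split_beta)
qed (fact assms complete rank)+

text \<open>Stands for the quotient map of \<open>A\<close> followed by an isomorphism onto
  \<open>Q\<close>, phrased without classes; both implications pass through it. For reduced
  \<open>Q\<close>, \<open>game_valuation_iso\<close> shows that equal values amount to
  indistinguishability.\<close>

locale game_valuation = bipartite_monoid Q P for Q (structure) and P +
  fixes A :: "game set" and \<phi> :: "game \<Rightarrow> 'a"
  assumes closed: "closed_games A"
    and image: "\<phi> ` A = carrier Q"
    and plus: "\<lbrakk>G \<in> A; H \<in> A\<rbrakk> \<Longrightarrow> \<phi> (G + H) = \<phi> G \<otimes> \<phi> H"
    and outcome: "G \<in> A \<Longrightarrow> \<phi> G \<in> P \<longleftrightarrow> misere_P G"
begin

lemma value_carrier: "G \<in> A \<Longrightarrow> \<phi> G \<in> carrier Q"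
  using image by blast

text \<open>Surjectivity supplies a game of value \<open>\<one>\<close>; evaluating
  \<open>0 + G = G\<close> for it gives the claim.\<close>

lemma value_zero: "\<phi> 0 = \<one>"
proof -
  obtain G where G: "G \<in> A" "\<phi> G = \<one>"
    using image one_closed by (metis imageE)
  with plus[OF closed_gamesD(1)[OF closed] G(1)] show ?thesis
    using value_carrier[OF closed_gamesD(1)[OF closed]] by simp
qed

text \<open>Parity is the recursion of \<open>misere_P\<close>, and closure is the formula for the
  options of a sum.\<close>

lemma valid_table:
  "valid_transition_table Q P {(\<phi> G, \<phi> ` fset (options G)) |G. G \<in> A}"
    (is "valid_transition_table Q P ?T")
proof -
  note cl = closed_gamesD[OF closed]
  \<comment> \<open>\<open>Suc n\<close> shifts sizes down by one: \<open>0\<close> has size 1, so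
    its value \<open>\<one>\<close> gets rank 0.\<close>
  define R where "R x = (LEAST n. \<exists>G\<in>A. \<phi> G = x \<and> size G = Suc n)" for x
  have R_le: "R (\<phi> G) \<le> size G - 1" if "G \<in> A" for G
    unfolding R_def using that size_game_pos[of G] by (intro Least_le) auto
  have R_attained: "\<exists>G\<in>A. \<phi> G = x \<and> size G = Suc (R x)" if "x \<in> carrier Q" for x
  proof -
    have "\<exists>n. \<exists>G\<in>A. \<phi> G = x \<and> size G = Suc n"
      using that image size_game_pos by (metis imageE Suc_pred)
    then show ?thesis unfolding R_def by (rule LeastI_ex)
  qed
  show ?thesis
  proof (rule valid_transition_tableI)
    show "?T \<subseteq> carrier Q \<times> Pow (carrier Q)"
      using value_carrier cl(2) by auto
    show "R \<one> = 0"
      using R_le[OF cl(1)] by (simp add: value_zero)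
  next
    fix x E assume "(x, E) \<in> ?T"
    then obtain G where "G \<in> A" "x = \<phi> G" "E = \<phi> ` fset (options G)" by blast
    then show "x \<in> P \<longleftrightarrow> E \<noteq> {} \<and> E \<inter> P = {}"
      using outcome cl(2) by (auto simp: misere_P.simps[of G])
  next
    fix x assume x: "x \<in> carrier Q"
    then obtain G where G: "G \<in> A" "\<phi> G = x" "size G = Suc (R x)"
      using R_attained by blast
    then show "\<exists>E. (x, E) \<in> ?T" by blast
    \<comment> \<open>\<open>G\<close> has least size among the games of value \<open>x\<close>, so
      an option, being smaller, has a value of smaller rank.\<close>
    have "R (\<phi> G') < R x" if "G' |\<in>| options G" for G'
      using R_le[OF cl(2)[OF G(1) that]] size_option_less[OF that] size_game_pos[of G'] G(3) by simp
    then show "\<exists>E. (x, E) \<in> ?T \<and> (\<forall>y\<in>E. R y < R x)" using G by blast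
  next
    fix x E y F assume "(x, E) \<in> ?T" "(y, F) \<in> ?T"
    then obtain G H where G: "G \<in> A" "x = \<phi> G" "E = \<phi> ` fset (options G)"
      and H: "H \<in> A" "y = \<phi> H" "F = \<phi> ` fset (options H)" by blast
    have "\<phi> ` (\<lambda>H'. G + H') ` fset (options H) = (\<lambda>z. x \<otimes> z) ` F"
      unfolding image_image G(2) H(3) by (intro image_cong refl plus G(1) cl(2)[OF H(1)])
    moreover have "\<phi> ` (\<lambda>G'. G' + H) ` fset (options G) = (\<lambda>z. y \<otimes> z) ` E"
      unfolding image_image add.commute[of _ H] G(3) H(2)
      by (intro image_cong refl plus H(1) cl(2)[OF G(1)])
    ultimately have "\<phi> ` fset (options (G + H)) = (\<lambda>z. x \<otimes> z) ` F \<union> (\<lambda>z. y \<otimes> z) ` E"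
      by (simp only: fset_options_plus image_Un Un_commute)
    then show "(x \<otimes> y, (\<lambda>z. x \<otimes> z) ` F \<union> (\<lambda>z. y \<otimes> z) ` E) \<in> ?T"
      using plus[OF G(1) H(1), symmetric] cl(3)[OF G(1) H(1)] G(2) H(2) by blast
  qed
qed

end

section \<open>Valuations and isomorphisms of the misere quotient\<close>

lemma iso_game_valuation:
  assumes "bipartite_monoid Q P" and A: "closed_games A"
    and iso: "bipartite_isomorphic (misere_quotient A) (misere_quotient_P A) Q P"
  obtains \<phi> where "game_valuation Q P A \<phi>"
proof -
  interpret bipartite_monoid Q P by fact
  let ?c = "\<lambda>G. indist A `` {G}"
  obtain h where h: "h \<in> iso (misere_quotient A) Q"
    and hP: "\<And>X. X \<in> carrier (misere_quotient A) \<Longrightarrow> X \<in> misere_quotient_P A \<longleftrightarrow> h X \<in> P"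
    using iso unfolding bipartite_isomorphic_def by blast
  have carr: "carrier (misere_quotient A) = ?c ` A"
    by (auto simp: misere_quotient_def quotient_def)
  have "game_valuation Q P A (\<lambda>G. h (?c G))"
  proof
    show "closed_games A" by fact
    show "(\<lambda>G. h (?c G)) ` A = carrier Q"
      using h by (simp add: iso_def bij_betw_def carr image_image)
    show "h (?c (G + H)) = h (?c G) \<otimes>\<^bsub>Q\<^esub> h (?c H)" if "G \<in> A" "H \<in> A" for G H
      using h that by (simp add: iso_def hom_def carr misere_quotient_mult[OF A, symmetric])
    show "h (?c G) \<in> P \<longleftrightarrow> misere_P G" if G: "G \<in> A" for G
    proof -
      \<comment> \<open>\<open>misere_quotient_P\<close> asks only for some representative to be a
        P-position; testing with \<open>X = 0\<close> shows that all representatives share their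
        outcome.\<close>
      have "misere_P G \<longleftrightarrow> misere_P H" if "?c G = ?c H" "H \<in> A" for H
      proof -
        have "(G, H) \<in> indist A"
          using eq_equiv_class[OF that(1) equiv_indist that(2)] .
        then have "misere_P (G + 0) \<longleftrightarrow> misere_P (H + 0)"
          using closed_gamesD(1)[OF A] unfolding indist_def by blast
        then show ?thesis by simp
      qed
      then have "?c G \<in> misere_quotient_P A \<longleftrightarrow> misere_P G"
        using G unfolding misere_quotient_P_def by blast
      then show ?thesis using hP[of "?c G"] G by (simp add: carr)
    qed
  qed
  then show ?thesis by (rule that)
qed

text \<open>The outcome of \<open>G + X\<close> is decided by the product of the values, and the
  value of \<open>X\<close> runs through all of \<open>Q\<close>. So indistinguishable games have
  values that no \<open>w\<close> separates, and reducedness makes these equal.\<close>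

lemma game_valuation_iso:
  assumes "reduced_bipartite_monoid Q P" and "game_valuation Q P A \<phi>"
  shows "bipartite_isomorphic (misere_quotient A) (misere_quotient_P A) Q P"
proof -
  interpret reduced_bipartite_monoid Q P by fact
  interpret game_valuation Q P A \<phi> by fact
  let ?c = "\<lambda>G. indist A `` {G}"
  note cl = closed_gamesD[OF closed]
  have carr: "carrier (misere_quotient A) = ?c ` A"
    by (auto simp: misere_quotient_def quotient_def)
  have indist_iff: "(G, H) \<in> indist A \<longleftrightarrow> \<phi> G = \<phi> H" if GH: "G \<in> A" "H \<in> A" for G H
  proof -
    have "misere_P (G + X) \<longleftrightarrow> \<phi> G \<otimes>\<^bsub>Q\<^esub> \<phi> X \<in> P" if "G \<in> A" "X \<in> A" for G X
      using outcome[OF cl(3)] plus that by simp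
    then have "(G, H) \<in> indist A \<longleftrightarrow> (\<forall>w\<in>\<phi> ` A. \<phi> G \<otimes>\<^bsub>Q\<^esub> w \<in> P \<longleftrightarrow> \<phi> H \<otimes>\<^bsub>Q\<^esub> w \<in> P)"
      using GH unfolding indist_def by simp
    also have "\<dots> \<longleftrightarrow> \<phi> G = \<phi> H"
      unfolding image using reduced value_carrier GH by metis
    finally show ?thesis .
  qed
  have class_eq: "?c G = ?c H \<longleftrightarrow> \<phi> G = \<phi> H" if "G \<in> A" "H \<in> A" for G H
    using eq_equiv_class_iff[OF equiv_indist that] indist_iff[OF that] by simp
  \<comment> \<open>The value of an arbitrary representative; by \<open>class_eq\<close> the choice
    is immaterial.\<close>
  define h where "h X = \<phi> (SOME G. G \<in> A \<and> X = ?c G)" for X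
  have h: "h (?c G) = \<phi> G" if "G \<in> A" for G
  proof -
    have "\<exists>H. H \<in> A \<and> ?c G = ?c H" using that by blast
    from someI_ex[OF this] show ?thesis unfolding h_def using class_eq that by metis
  qed
  have "h \<in> iso (misere_quotient A) Q"
    unfolding iso_def hom_def bij_betw_def inj_on_def carr
    using h class_eq plus value_carrier image cl(3)
    by (auto simp: misere_quotient_mult[OF closed] image_image)
  moreover have "?c G \<in> misere_quotient_P A \<longleftrightarrow> h (?c G) \<in> P" if "G \<in> A" for G
    unfolding misere_quotient_P_def using h class_eq that by (auto simp flip: outcome)
  ultimately show ?thesis
    unfolding bipartite_isomorphic_def carr by blast
qed

section \<open>From a transition table to games\<close>

text \<open>A relation, since a game could a priori have several values; uniqueness comes only after
  every element is known to be a value. The two matching conditions say that \<open>E\<close> is a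
  set of values of the options, hitting each option.\<close>

inductive realizes :: "('a \<times> 'a set) set \<Rightarrow> game \<Rightarrow> 'a \<Rightarrow> bool" for T where
  realizesI: "\<lbrakk>(x, E) \<in> T; \<forall>G'\<in>fset (options G). \<exists>y\<in>E. realizes T G' y;
    \<forall>y\<in>E. \<exists>G'\<in>fset (options G). realizes T G' y\<rbrakk> \<Longrightarrow> realizes T G x"

locale transition_table = reduced_bipartite_monoid Q P for Q (structure) and P +
  fixes T R
  assumes T_subset: "T \<subseteq> carrier Q \<times> Pow (carrier Q)"
    and parity: "(x, E) \<in> T \<Longrightarrow> x \<in> P \<longleftrightarrow> E \<noteq> {} \<and> E \<inter> P = {}"
    and table_closed: "\<lbrakk>(x, E) \<in> T; (y, F) \<in> T\<rbrakk> \<Longrightarrow>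
      (x \<otimes> y, (\<lambda>z. x \<otimes> z) ` F \<union> (\<lambda>z. y \<otimes> z) ` E) \<in> T"
    and rank_one: "R \<one> = (0 :: nat)"
    and ranked: "x \<in> carrier Q \<Longrightarrow> \<exists>E. (x, E) \<in> T \<and> (\<forall>y\<in>E. R y < R x)"
begin

lemma entry_carrier: "(x, E) \<in> T \<Longrightarrow> x \<in> carrier Q" "(x, E) \<in> T \<Longrightarrow> E \<subseteq> carrier Q"
  using T_subset by auto

text \<open>Multiply both entries by a rank-decreasing entry \<open>(w, F)\<close>. The two
  resulting sets share the translate of \<open>E\<close> by \<open>w\<close>, and the translates of
  \<open>F\<close> by \<open>x\<close> and \<open>x'\<close> agree about \<open>P\<close> by
  induction on \<open>R w\<close>. Parity then carries the agreement to \<open>w\<close>, and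
  reducedness concludes.\<close>

lemma entry_unique:
  assumes "(x, E) \<in> T" "(x', E) \<in> T"
  shows "x = x'"
proof -
  have "x \<otimes> w \<in> P \<longleftrightarrow> x' \<otimes> w \<in> P" if "w \<in> carrier Q" for w
    using that
  proof (induction "R w" arbitrary: w rule: less_induct)
    case less
    obtain F where F: "(w, F) \<in> T" "\<forall>y\<in>F. R y < R w"
      using ranked[OF less.prems] by blast
    have "x \<otimes> y \<in> P \<longleftrightarrow> x' \<otimes> y \<in> P" if "y \<in> F" for y
      using less.hyps that F entry_carrier(2)[OF F(1)] by blast
    then show ?case
      using parity[OF table_closed[OF assms(1) F(1)]] parity[OF table_closed[OF assms(2) F(1)]]
      by auto
  qed
  then show ?thesis using reduced entry_carrier(1) assms by metis
qed

text \<open>Choosing a rank-decreasing entry for each element is injective by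
  \<open>entry_unique\<close>, and it maps the elements of rank below \<open>Suc n\<close> to
  subsets of those of rank below \<open>n\<close>.\<close>

lemma finite_rank_less: "finite {x \<in> carrier Q. R x < n}"
proof (induction n)
  case (Suc n)
  obtain E where E: "\<And>x. x \<in> carrier Q \<Longrightarrow> (x, E x) \<in> T \<and> (\<forall>y\<in>E x. R y < R x)"
    using ranked by metis
  have "E ` {x \<in> carrier Q. R x < Suc n} \<subseteq> Pow {x \<in> carrier Q. R x < n}"
  proof (clarsimp, intro conjI)
    fix x y assume "x \<in> carrier Q" "R x < Suc n" "y \<in> E x"
    then show "y \<in> carrier Q" "R y < n"
      using E[of x] entry_carrier(2)[of x "E x"] by fastforce+
  qed
  then have "finite (E ` {x \<in> carrier Q. R x < Suc n})"
    using Suc.IH by (simp add: finite_subset)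
  moreover have "inj_on E {x \<in> carrier Q. R x < Suc n}"
    using E entry_unique by (intro inj_onI) (metis (mono_tags, lifting) mem_Collect_eq)
  ultimately show ?case by (rule finite_imageD)
qed simp

lemma realizes_carrier: "realizes T G x \<Longrightarrow> x \<in> carrier Q"
  by (auto elim: realizes.cases dest: entry_carrier)

lemma realizes_zero: "realizes T 0 \<one>"
proof -
  \<comment> \<open>As \<open>R \<one> = 0\<close>, this forces \<open>E = {}\<close>, which matches
    the lack of options of \<open>0\<close>.\<close>
  obtain E where "(\<one>, E) \<in> T" "\<forall>y\<in>E. R y < R \<one>" using ranked[of \<one>] by auto
  then show ?thesis using rank_one by (intro realizesI[of _ E]) auto
qed

text \<open>Closure of the table mirrors the options of a sum: moves in \<open>H\<close> give the
  multiples of \<open>F\<close> by \<open>x\<close>, moves in \<open>G\<close> the multiples of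
  \<open>E\<close> by \<open>y\<close>.\<close>

lemma realizes_plus:
  "\<lbrakk>realizes T G x; realizes T H y\<rbrakk> \<Longrightarrow> realizes T (G + H) (x \<otimes> y)"
proof (induction "size G + size H" arbitrary: G H x y rule: less_induct)
  case less
  obtain E where E: "(x, E) \<in> T" "\<forall>G'\<in>fset (options G). \<exists>u\<in>E. realizes T G' u"
    "\<forall>u\<in>E. \<exists>G'\<in>fset (options G). realizes T G' u"
    using less.prems(1) by (auto elim: realizes.cases)
  obtain F where F: "(y, F) \<in> T" "\<forall>H'\<in>fset (options H). \<exists>v\<in>F. realizes T H' v"
    "\<forall>v\<in>F. \<exists>H'\<in>fset (options H). realizes T H' v"
    using less.prems(2) by (auto elim: realizes.cases)
  have left: "realizes T (G' + H) (y \<otimes> u)" if "G' \<in> fset (options G)" "realizes T G' u" for G' u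
    using less.hyps[OF _ that(2) less.prems(2)] size_option_less[OF that(1)]
      realizes_carrier[OF that(2)] realizes_carrier[OF less.prems(2)] by (simp add: m_comm)
  have right: "realizes T (G + H') (x \<otimes> v)" if "H' \<in> fset (options H)" "realizes T H' v" for H' v
    using less.hyps[OF _ less.prems(1) that(2)] size_option_less[OF that(1)] by simp
  show ?case
  proof (rule realizesI[OF table_closed[OF E(1) F(1)]], unfold fset_options_plus)
    show "\<forall>K\<in>(\<lambda>G'. G' + H) ` fset (options G) \<union> (\<lambda>H'. G + H') ` fset (options H).
        \<exists>z\<in>(\<lambda>z. x \<otimes> z) ` F \<union> (\<lambda>z. y \<otimes> z) ` E. realizes T K z"
    proof (intro ballI, elim UnE imageE)
      fix K G' assume K: "K = G' + H" "G' \<in> fset (options G)"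
      then obtain u where "u \<in> E" "realizes T G' u" using E(2) by blast
      then show "\<exists>z\<in>(\<lambda>z. x \<otimes> z) ` F \<union> (\<lambda>z. y \<otimes> z) ` E. realizes T K z"
        unfolding K(1) using left[OF K(2)] by auto
    next
      fix K H' assume K: "K = G + H'" "H' \<in> fset (options H)"
      then obtain v where "v \<in> F" "realizes T H' v" using F(2) by blast
      then show "\<exists>z\<in>(\<lambda>z. x \<otimes> z) ` F \<union> (\<lambda>z. y \<otimes> z) ` E. realizes T K z"
        unfolding K(1) using right[OF K(2)] by auto
    qed
    show "\<forall>z\<in>(\<lambda>z. x \<otimes> z) ` F \<union> (\<lambda>z. y \<otimes> z) ` E.
        \<exists>K\<in>(\<lambda>G'. G' + H) ` fset (options G) \<union> (\<lambda>H'. G + H') ` fset (options H). realizes T K z"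
    proof (intro ballI, elim UnE imageE)
      fix z v assume z: "z = x \<otimes> v" "v \<in> F"
      then obtain H' where "H' \<in> fset (options H)" "realizes T H' v" using F(3) by blast
      then show "\<exists>K\<in>(\<lambda>G'. G' + H) ` fset (options G) \<union> (\<lambda>H'. G + H') ` fset (options H).
          realizes T K z"
        unfolding z(1) using right by auto
    next
      fix z u assume z: "z = y \<otimes> u" "u \<in> E"
      then obtain G' where "G' \<in> fset (options G)" "realizes T G' u" using E(3) by blast
      then show "\<exists>K\<in>(\<lambda>G'. G' + H) ` fset (options G) \<union> (\<lambda>H'. G + H') ` fset (options H).
          realizes T K z"
        unfolding z(1) using left by auto
    qed
  qed
qed

text \<open>Parity and \<open>misere_P\<close> are the same recursion once \<open>E\<close> and the
  options are matched in both directions.\<close>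

lemma realizes_outcome: "realizes T G x \<Longrightarrow> x \<in> P \<longleftrightarrow> misere_P G"
proof (induction rule: realizes.induct)
  case (realizesI x E G)
  have "E = {} \<longleftrightarrow> G = 0"
    using realizesI(2,3) fset_options_eq_empty_iff[of G] by blast
  moreover have "E \<inter> P = {} \<longleftrightarrow> (\<forall>G'. G' |\<in>| options G \<longrightarrow> \<not> misere_P G')"
    using realizesI(2,3) by blast
  ultimately show ?case
    using parity[OF realizesI(1)] misere_P.simps[of G] by blast
qed

text \<open>If \<open>H\<close> has value \<open>w\<close>, then \<open>x \<otimes> w\<close> and
  \<open>y \<otimes> w\<close> are both values of \<open>G + H\<close>, whose outcome decides their
  membership in \<open>P\<close>. Reducedness then applies.\<close>

lemma realizes_unique:
  assumes "realizes T G x" "realizes T G y" and surj: "\<And>w. w \<in> carrier Q \<Longrightarrow> \<exists>H. realizes T H w"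
  shows "x = y"
proof -
  have "x \<otimes> w \<in> P \<longleftrightarrow> y \<otimes> w \<in> P" if "w \<in> carrier Q" for w
    using surj[OF that] assms(1,2) realizes_plus realizes_outcome by metis
  then show ?thesis using reduced realizes_carrier assms(1,2) by metis
qed

lemma realizes_surj: "x \<in> carrier Q \<Longrightarrow> \<exists>G. realizes T G x"
proof (induction "R x" arbitrary: x rule: less_induct)
  case less
  obtain E where E: "(x, E) \<in> T" "\<forall>y\<in>E. R y < R x" using ranked[OF less.prems] by blast
  \<comment> \<open>A game has only finitely many options, so \<open>E\<close> must be finite for
    its elements to serve as their values.\<close>
  have "finite E"
    by (rule finite_subset[OF _ finite_rank_less[of "R x"]]) (use E entry_carrier in blast)
  then obtain N where N: "fset N = E" using Abs_fset_inverse[of E] by blast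
  obtain g where g: "\<And>y. y \<in> E \<Longrightarrow> realizes T (g y) y"
    using less.hyps E entry_carrier(2)[OF E(1)] by (metis subsetD)
  \<comment> \<open>The options are one chosen game for each value in \<open>E\<close>.\<close>
  have "realizes T (Game (g |`| N)) x"
    using g by (intro realizesI[OF E(1)]) (auto simp: N)
  then show ?case ..
qed

lemma game_valuation_realizes:
  "game_valuation Q P {G. \<exists>x. realizes T G x} (\<lambda>G. THE x. realizes T G x)"
proof -
  have val: "(THE x. realizes T G x) = x" if "realizes T G x" for G x
    using that realizes_unique realizes_surj by (intro the_equality) blast+
  show ?thesis
  proof
    \<comment> \<open>Having a value is hereditary: the entry used for \<open>G\<close> contains a
      value of each option.\<close>
    have "\<exists>y. realizes T G' y" if "realizes T G x" "G' |\<in>| options G" for G G' x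
      using that by cases blast
    then show "closed_games {G. \<exists>x. realizes T G x}"
      unfolding closed_games_def using realizes_zero realizes_plus by blast
    show "(\<lambda>G. THE x. realizes T G x) ` {G. \<exists>x. realizes T G x} = carrier Q"
    proof (intro equalityI subsetI)
      show "x \<in> (\<lambda>G. THE x. realizes T G x) ` {G. \<exists>x. realizes T G x}" if "x \<in> carrier Q" for x
        using realizes_surj[OF that] val by (metis (mono_tags, lifting) image_eqI mem_Collect_eq)
    qed (auto simp: val realizes_carrier)
  qed (use realizes_plus in \<open>auto simp: val realizes_outcome\<close>)
qed

end

theorem theorem7p4:
  fixes Q :: "('a, 'm) monoid_scheme" and P :: "'a set"
  assumes "reduced_bipartite_monoid Q P"
    and "\<one>\<^bsub>Q\<^esub> \<notin> P"
  shows "(\<exists>A. closed_games A \<and>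
            bipartite_isomorphic (misere_quotient A) (misere_quotient_P A) Q P)
         \<longleftrightarrow> (\<exists>T. valid_transition_table Q P T)"
proof
  assume "\<exists>A. closed_games A \<and> bipartite_isomorphic (misere_quotient A) (misere_quotient_P A) Q P"
  then obtain A where A: "closed_games A"
    "bipartite_isomorphic (misere_quotient A) (misere_quotient_P A) Q P" by blast
  obtain \<phi> where "game_valuation Q P A \<phi>"
    by (rule iso_game_valuation[OF reduced_bipartite_monoid.axioms(1)[OF assms(1)] A])
  then show "\<exists>T. valid_transition_table Q P T"
    using game_valuation.valid_table by blast
next
  assume "\<exists>T. valid_transition_table Q P T"
  then obtain T where T: "valid_transition_table Q P T" ..
  then obtain R :: "'a \<Rightarrow> nat" where subset: "T \<subseteq> carrier Q \<times> Pow (carrier Q)"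
    and parity: "\<forall>(x, E)\<in>T. x \<in> P \<longleftrightarrow> E \<noteq> {} \<and> E \<inter> P = {}"
    and closure: "\<forall>(x, E)\<in>T. \<forall>(y, F)\<in>T.
      (x \<otimes>\<^bsub>Q\<^esub> y, (\<lambda>z. x \<otimes>\<^bsub>Q\<^esub> z) ` F \<union> (\<lambda>z. y \<otimes>\<^bsub>Q\<^esub> z) ` E) \<in> T"
    and rank: "R \<one>\<^bsub>Q\<^esub> = 0" "\<forall>x\<in>carrier Q. \<exists>E. (x, E) \<in> T \<and> (\<forall>y\<in>E. R y < R x)"
    unfolding valid_transition_table_def by (elim conjE exE) (rule that)
  interpret reduced_bipartite_monoid Q P by fact
  interpret transition_table Q P T R
  proof
    show "x \<in> P \<longleftrightarrow> E \<noteq> {} \<and> E \<inter> P = {}" if "(x, E) \<in> T" for x E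
      using bspec[OF parity that] by simp
    show "(x \<otimes>\<^bsub>Q\<^esub> y, (\<lambda>z. x \<otimes>\<^bsub>Q\<^esub> z) ` F \<union> (\<lambda>z. y \<otimes>\<^bsub>Q\<^esub> z) ` E) \<in> T"
      if "(x, E) \<in> T" "(y, F) \<in> T" for x E y F
      using bspec[OF bspec[OF closure that(1), unfolded prod.case] that(2)] by simp
  qed (use subset rank in simp_all)
  \<comment> \<open>The witness is the set of all games that have a value.\<close>
  show "\<exists>A. closed_games A \<and> bipartite_isomorphic (misere_quotient A) (misere_quotient_P A) Q P"
    using game_valuation_realizes game_valuation_iso[OF assms(1)] game_valuation.closed by blast
qed

end
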